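(* Let $k\ge 1$ be an integer. For every $n\ge 1$, the number $\underline{w}_k(n)$ of binary strings of length $n$ that contain at least one $1$ and whose shortest nonnull run of ones has length exactly $k$ is the coefficient of $x^n$ in $$\frac{x^k(1-x)^2}{\big((1-x)^2-x^{k+1}\big)\big((1-x)^2-x^{k+2}\big)}.$$
   Context: A nonnull run of ones is a maximal block of consecutive ones of length at least $1$, flanked on each side by a zero or by the start/end of the string. *)

theory Defs
  imports "HOL-Computational_Algebra.Formal_Power_Series"
begin

text \<open>Binary strings are boolean lists, with \<^const>\<open>True\<close> for the digit one and
  \<^const>\<open>False\<close> for the digit zero.\<close>

text \<open>\<open>is_one_run w i l\<close>: the block of length \<open>l\<close> starting at position \<open>i\<close> (counted from 0)
  is a nonnull run of ones of \<open>w\<close>.\<close>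

definition is_one_run :: "bool list \<Rightarrow> nat \<Rightarrow> nat \<Rightarrow> bool" where
  "is_one_run w i l \<longleftrightarrow>
     l \<ge> 1 \<and> i + l \<le> length w \<and>
     (\<forall>j. i \<le> j \<and> j < i + l \<longrightarrow> w ! j) \<and>
     (i = 0 \<or> \<not> w ! (i - 1)) \<and>
     (i + l = length w \<or> \<not> w ! (i + l))"

definition one_run_lengths :: "bool list \<Rightarrow> nat set" where
  "one_run_lengths w = {l. \<exists>i. is_one_run w i l}"

text \<open>Only meaningful for strings containing a one, as \<^term>\<open>one_run_lengths w\<close> is
  empty otherwise.\<close>

definition shortest_one_run :: "bool list \<Rightarrow> nat" where
  "shortest_one_run w = Min (one_run_lengths w)"

definition num_shortest_run :: "nat \<Rightarrow> nat \<Rightarrow> nat" where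
  "num_shortest_run k n =
     card {w :: bool list. length w = n \<and> True \<in> set w \<and> shortest_one_run w = k}"

end

theory Submission
  imports Defs
begin

text \<open>A string containing a one has shortest run \<open>k\<close> exactly when all its runs have length at least
  \<open>k\<close> but not all have length at least \<open>k + 1\<close>. So the count sought is a difference of two
  consecutive counts of strings whose runs are bounded below, and those have a simple generating
  function \<open>A\<^sub>k\<close>.

  Cutting such a string at its first zero leaves either a block of ones only, or a block of
  ones, a zero, and another string of the same kind; the block is empty or has length at least \<open>k\<close>.
  With the generating function \<open>G = 1 + x\<^sup>k / (1 - x)\<close> of the permitted blocks this reads
  \<open>A\<^sub>k = G + x G A\<^sub>k\<close>, that is, \<open>A\<^sub>k ((1 - x)\<^sup>2 - x\<^sup>k\<^sup>+\<^sup>1) = 1 - x + x\<^sup>k\<close>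
  (lemma \<open>long_run_fps_eq\<close>). Subtracting \<open>A\<^sub>k\<^sub>+\<^sub>1\<close> from \<open>A\<^sub>k\<close> gives the stated fraction.\<close>

section \<open>Runs and the first zero\<close>

lemma is_one_run_replicate:
  "is_one_run (replicate n True) i l \<longleftrightarrow> i = 0 \<and> l = n \<and> n \<ge> 1"
  by (cases "i = 0"; cases "i + l = n") (auto simp: is_one_run_def)

text \<open>The zero at position \<open>j\<close> separates: no run contains it, and for a run starting right
  after it the zero serves as the left flank, just as the start of the string \<open>w\<close> does.\<close>

lemma is_one_run_append:
  "is_one_run (replicate j True @ False # w) i l \<longleftrightarrow>
     i = 0 \<and> l = j \<and> j \<ge> 1 \<or> i \<ge> Suc j \<and> is_one_run w (i - Suc j) l"
  (is "is_one_run ?w i l \<longleftrightarrow> _")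
proof -
  have left: "?w ! m" if "m < j" for m
    using that by (simp add: nth_append)
  have mid: "\<not> ?w ! j"
    by (simp add: nth_append)
  have right: "?w ! (m + Suc j) = w ! m" for m
    by (simp add: nth_append)
  show ?thesis
  proof (cases "i \<ge> Suc j")
    case True
    then obtain p where i: "i = p + Suc j"
      by (metis le_add_diff_inverse2)
    have "(\<forall>m. i \<le> m \<and> m < i + l \<longrightarrow> ?w ! m) \<longleftrightarrow> (\<forall>m. p \<le> m \<and> m < p + l \<longrightarrow> w ! m)"
    proof safe
      fix m
      assume "\<forall>m. i \<le> m \<and> m < i + l \<longrightarrow> ?w ! m" "p \<le> m" "m < p + l"
      then show "w ! m"
        using right[of m] i by simp
    next
      fix m
      assume *: "\<forall>m. p \<le> m \<and> m < p + l \<longrightarrow> w ! m" "i \<le> m" "m < i + l"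
      then obtain q where "m = q + Suc j" "p \<le> q" "q < p + l"
        using i by (intro that[of "m - Suc j"]) linarith+
      then show "?w ! m"
        using right[of q] * by simp
    qed
    moreover have "\<not> ?w ! (i - 1) \<longleftrightarrow> p = 0 \<or> \<not> w ! (p - 1)"
      using mid right[of "p - 1"] by (cases p) (simp_all add: i)
    moreover have "?w ! (i + l) = w ! (p + l)"
      using right[of "p + l"] by (simp add: i ac_simps)
    ultimately show ?thesis
      unfolding is_one_run_def by (simp add: i)
  next
    case False
    show ?thesis
    proof
      assume run: "is_one_run ?w i l"
      then have "l \<ge> 1" and ones: "\<And>m. i \<le> m \<Longrightarrow> m < i + l \<Longrightarrow> ?w ! m"
        and start: "i = 0 \<or> \<not> ?w ! (i - 1)"
        and stop: "i + l = length ?w \<or> \<not> ?w ! (i + l)"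
        by (auto simp: is_one_run_def)
      have "i + l \<le> j"
        using ones[of j] mid False by (meson not_less not_less_eq_eq)
      moreover have "\<not> i + l < j"
        using stop left[of "i + l"] by auto
      moreover have "i = 0"
        using start left[of "i - 1"] False by (cases i) auto
      ultimately show "i = 0 \<and> l = j \<and> j \<ge> 1 \<or> i \<ge> Suc j \<and> is_one_run w (i - Suc j) l"
        using \<open>l \<ge> 1\<close> by simp
    next
      assume "i = 0 \<and> l = j \<and> j \<ge> 1 \<or> i \<ge> Suc j \<and> is_one_run w (i - Suc j) l"
      then show "is_one_run ?w i l"
        using False left mid by (auto simp: is_one_run_def)
    qed
  qed
qed

lemma one_run_lengths_replicate:
  "one_run_lengths (replicate n True) = (if n = 0 then {} else {n})"
  by (auto simp: one_run_lengths_def is_one_run_replicate)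

lemma one_run_lengths_append:
  "one_run_lengths (replicate j True @ False # w) =
     (if j = 0 then {} else {j}) \<union> one_run_lengths w"
proof -
  have "(\<exists>i \<ge> Suc j. is_one_run w (i - Suc j) l) \<longleftrightarrow> (\<exists>i. is_one_run w i l)" for l
    by (metis add_diff_cancel_right' le_add2)
  then show ?thesis
    by (auto simp: one_run_lengths_def is_one_run_append)
qed

lemma first_zero_cases:
  obtains (ones) "w = replicate (length w) True"
  | (zero) j u where "w = replicate j True @ False # u"
proof (cases "False \<in> set w")
  case True
  then obtain v u where "w = v @ False # u" "False \<notin> set v"
    by (meson split_list_first)
  moreover have "v = replicate (length v) True"
    using \<open>False \<notin> set v\<close> by (metis (full_types) replicate_eqI)
  ultimately show ?thesis
    using zero by metis
next
  case False
  then show ?thesis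
    using ones by (metis (full_types) replicate_eqI)
qed

lemma first_zero_unique:
  "replicate i True @ False # u = replicate j True @ False # v \<longleftrightarrow> i = j \<and> u = v"
proof (induction i arbitrary: j)
  case 0
  then show ?case by (cases j) auto
next
  case (Suc i)
  then show ?case by (cases j) auto
qed

lemma one_run_lengths_eq_empty_iff: "one_run_lengths w = {} \<longleftrightarrow> True \<notin> set w"
proof (induction "length w" arbitrary: w rule: less_induct)
  case less
  show ?case
  proof (cases w rule: first_zero_cases)
    case ones
    then obtain n where "w = replicate n True" by blast
    then show ?thesis by (simp add: one_run_lengths_replicate)
  next
    case (zero j u)
    then show ?thesis
      using less[of u] by (simp add: one_run_lengths_append)
  qed
qed

lemma finite_one_run_lengths: "finite (one_run_lengths w)"
  by (rule finite_subset[of _ "{..length w}"]) (auto simp: one_run_lengths_def is_one_run_def)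

section \<open>Strings whose runs are bounded below\<close>

definition long_run_strings :: "nat \<Rightarrow> nat \<Rightarrow> bool list set" where
  "long_run_strings k n = {w. length w = n \<and> (\<forall>l \<in> one_run_lengths w. k \<le> l)}"

lemma finite_long_run_strings: "finite (long_run_strings k n)"
  by (rule finite_subset[OF _ finite_lists_length_eq[of "UNIV :: bool set" n]])
    (auto simp: long_run_strings_def)

text \<open>The strings without a one belong to both sets on the right and cancel, which is why the
  condition that a one occurs leaves no trace there.\<close>

lemma num_shortest_run_eq:
  "num_shortest_run k n = card (long_run_strings k n) - card (long_run_strings (Suc k) n)"
proof -
  have "True \<in> set w \<and> shortest_one_run w = k \<longleftrightarrow>
      (\<forall>l \<in> one_run_lengths w. k \<le> l) \<and> \<not> (\<forall>l \<in> one_run_lengths w. Suc k \<le> l)" for w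
  proof (cases "one_run_lengths w = {}")
    case True
    then show ?thesis
      using one_run_lengths_eq_empty_iff by auto
  next
    case False
    then have "shortest_one_run w = k \<longleftrightarrow>
        k \<in> one_run_lengths w \<and> (\<forall>l \<in> one_run_lengths w. k \<le> l)"
      unfolding shortest_one_run_def by (simp add: Min_eq_iff finite_one_run_lengths)
    moreover have "True \<in> set w"
      using False one_run_lengths_eq_empty_iff by auto
    ultimately show ?thesis
      by (metis le_antisym not_less_eq_eq)
  qed
  then have "{w. length w = n \<and> True \<in> set w \<and> shortest_one_run w = k} =
      long_run_strings k n - long_run_strings (Suc k) n"
    unfolding long_run_strings_def by blast
  moreover have "long_run_strings (Suc k) n \<subseteq> long_run_strings k n"
    by (auto simp: long_run_strings_def)
  ultimately show ?thesis
    unfolding num_shortest_run_def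
    by (simp add: card_Diff_subset finite_long_run_strings)
qed

lemma card_long_run_strings_mono:
  "card (long_run_strings (Suc k) n) \<le> card (long_run_strings k n)"
  by (rule card_mono[OF finite_long_run_strings]) (auto simp: long_run_strings_def)

definition block_lengths :: "nat \<Rightarrow> nat set" where
  "block_lengths k = {j. j = 0 \<or> k \<le> j}"

lemma long_run_strings_decomp:
  "long_run_strings k n =
     (if n \<in> block_lengths k then {replicate n True} else {}) \<union>
     (\<Union>j \<in> {j \<in> block_lengths k. j < n}.
        (\<lambda>u. replicate j True @ False # u) ` long_run_strings k (n - 1 - j))"
  (is "?L = ?R")
proof (rule set_eqI)
  fix w
  show "w \<in> ?L \<longleftrightarrow> w \<in> ?R"
  proof (cases w rule: first_zero_cases)
    case ones
    then obtain m where w: "w = replicate m True" by blast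
    have "replicate m True \<noteq> replicate j True @ False # u" for j u
      by (metis in_set_conv_decomp in_set_replicate)
    then show ?thesis
      unfolding w
      by (auto simp: long_run_strings_def one_run_lengths_replicate block_lengths_def
          split: if_splits)
  next
    case (zero j u)
    have "replicate j True @ False # u \<noteq> replicate n True"
      by (metis in_set_conv_decomp in_set_replicate)
    then show ?thesis
      unfolding zero
      by (auto simp: long_run_strings_def one_run_lengths_append block_lengths_def
          first_zero_unique image_iff split: if_splits)
  qed
qed

text \<open>By uniqueness of the cut at the first zero, the parts of the decomposition are disjoint and
  the prefixing maps are injective, so the cardinalities add up to a convolution.\<close>

lemma card_long_run_strings_rec:
  "card (long_run_strings k n) =
     of_bool (n \<in> block_lengths k) +
     (\<Sum>j<n. of_bool (j \<in> block_lengths k) * card (long_run_strings k (n - 1 - j)))"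
proof -
  define J where "J = {j \<in> block_lengths k. j < n}"
  define P where
    "P j = (\<lambda>u. replicate j True @ False # u) ` long_run_strings k (n - 1 - j)" for j
  have J: "finite J" "J = {j \<in> {..<n}. j \<in> block_lengths k}"
    by (auto simp: J_def)
  have fin: "finite (P j)" for j
    by (simp add: P_def finite_long_run_strings)
  have "card (\<Union>j \<in> J. P j) = (\<Sum>j \<in> J. card (P j))"
    using fin J(1) by (intro card_UN_disjoint) (auto simp: P_def first_zero_unique)
  also have "\<dots> = (\<Sum>j \<in> J. card (long_run_strings k (n - 1 - j)))"
    unfolding P_def by (intro sum.cong card_image refl inj_onI) (simp add: first_zero_unique)
  also have "\<dots> = (\<Sum>j<n. of_bool (j \<in> block_lengths k) * card (long_run_strings k (n - 1 - j)))"
    unfolding J(2) by (subst sum.inter_filter, simp, rule sum.cong[OF refl], simp)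
  finally have blocks: "card (\<Union>j \<in> J. P j) = \<dots>" .
  have "replicate n True \<notin> P j" for j
    unfolding P_def by (metis (no_types, lifting) imageE in_set_conv_decomp in_set_replicate)
  then have "card ((if n \<in> block_lengths k then {replicate n True} else {}) \<union> (\<Union>j \<in> J. P j)) =
      of_bool (n \<in> block_lengths k) + card (\<Union>j \<in> J. P j)"
    using fin J(1) by auto
  then show ?thesis
    unfolding blocks long_run_strings_decomp[of k n, folded J_def P_def] .
qed

section \<open>Generating functions\<close>

definition block_fps :: "nat \<Rightarrow> rat fps" where
  "block_fps k = Abs_fps (\<lambda>n. of_bool (n \<in> block_lengths k))"

definition long_run_fps :: "nat \<Rightarrow> rat fps" where
  "long_run_fps k = Abs_fps (\<lambda>n. of_nat (card (long_run_strings k n)))"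

text \<open>This is \<open>G = 1 + x\<^sup>k / (1 - x)\<close> with the denominator cleared. It fails for \<open>k = 0\<close>, where
  the block of length \<open>0\<close> would be counted twice.\<close>

lemma block_fps_eq:
  assumes "k \<ge> 1"
  shows "block_fps k * (1 - fps_X) = 1 - fps_X + fps_X ^ k"
proof (rule fps_ext)
  fix n
  show "fps_nth (block_fps k * (1 - fps_X)) n = fps_nth (1 - fps_X + fps_X ^ k) n"
    using assms
    by (cases n) (auto simp: block_fps_def block_lengths_def right_diff_distrib)
qed

lemma long_run_fps_functional_eq:
  "long_run_fps k = block_fps k + fps_X * (block_fps k * long_run_fps k)"
proof (rule fps_ext)
  fix n
  have "fps_nth (fps_X * (block_fps k * long_run_fps k)) n =
      (\<Sum>j<n. of_bool (j \<in> block_lengths k) * of_nat (card (long_run_strings k (n - 1 - j))))"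
  proof (cases n)
    case (Suc m)
    have "fps_nth (fps_X * F) (Suc m) = fps_nth F m" for F :: "rat fps"
      by simp
    then have "fps_nth (fps_X * (block_fps k * long_run_fps k)) n =
        (\<Sum>j = 0..m. fps_nth (block_fps k) j * fps_nth (long_run_fps k) (m - j))"
      unfolding Suc fps_mult_nth[symmetric] .
    then show ?thesis
      by (simp add: Suc block_fps_def long_run_fps_def atLeast0AtMost lessThan_Suc_atMost)
  qed simp
  then show "fps_nth (long_run_fps k) n =
      fps_nth (block_fps k + fps_X * (block_fps k * long_run_fps k)) n"
    by (simp add: card_long_run_strings_rec[of k n] block_fps_def long_run_fps_def)
qed

lemma long_run_fps_eq:
  assumes "k \<ge> 1"
  shows "long_run_fps k * ((1 - fps_X)\<^sup>2 - fps_X ^ (k + 1)) = 1 - fps_X + fps_X ^ k"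
proof -
  define A G where "A = long_run_fps k" and "G = block_fps k"
  have A: "A = G + fps_X * (G * A)"
    unfolding A_def G_def by (rule long_run_fps_functional_eq)
  have G: "G * (1 - fps_X) = 1 - fps_X + fps_X ^ k"
    unfolding G_def by (rule block_fps_eq[OF assms])
  have "A * (1 - fps_X) = G * (1 - fps_X) + fps_X * (G * (1 - fps_X)) * A"
    by (subst A) (simp add: algebra_simps)
  then have "A * (1 - fps_X) = (1 - fps_X + fps_X ^ k) + fps_X * (1 - fps_X + fps_X ^ k) * A"
    unfolding G .
  then show ?thesis
    unfolding A_def[symmetric] by (simp add: algebra_simps power2_eq_square)
qed

theorem mainTheorem10:
  fixes k n :: nat
  assumes "k \<ge> 1" and "n \<ge> 1"
  shows "of_nat (num_shortest_run k n) =
    fps_nth (fps_X ^ k * (1 - fps_X)\<^sup>2 /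
      (((1 - fps_X)\<^sup>2 - fps_X ^ (k + 1)) * ((1 - fps_X)\<^sup>2 - fps_X ^ (k + 2))) :: rat fps) n"
proof -
  define D :: "nat \<Rightarrow> rat fps" where "D m = (1 - fps_X)\<^sup>2 - fps_X ^ (m + 1)" for m
  define A where "A = long_run_fps"
  have nonzero: "D m \<noteq> 0" for m
  proof -
    have "fps_nth (D m) 0 = 1"
      by (simp add: D_def power2_eq_square)
    then show ?thesis by auto
  qed
  have eq: "A m * D m = 1 - fps_X + fps_X ^ m" if "m \<ge> 1" for m
    using long_run_fps_eq[OF that] by (simp add: A_def D_def)
  have "(A k - A (Suc k)) * (D k * D (Suc k)) =
      (A k * D k) * D (Suc k) - (A (Suc k) * D (Suc k)) * D k"
    by (simp add: algebra_simps)
  also have "\<dots> = (1 - fps_X + fps_X ^ k) * D (Suc k) - (1 - fps_X + fps_X ^ Suc k) * D k"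
    using assms(1) by (simp add: eq)
  also have "\<dots> = fps_X ^ k * (1 - fps_X)\<^sup>2"
    by (simp add: D_def algebra_simps power2_eq_square)
  finally have "A k - A (Suc k) = fps_X ^ k * (1 - fps_X)\<^sup>2 / (D k * D (Suc k))"
    using nonzero by (metis mult_eq_0_iff nonzero_mult_div_cancel_right)
  moreover have "of_nat (num_shortest_run k n) = fps_nth (A k - A (Suc k)) n"
    by (simp add: num_shortest_run_eq A_def long_run_fps_def of_nat_diff
        card_long_run_strings_mono)
  ultimately show ?thesis
    by (simp add: D_def)
qed

end
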